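(* Let $C$ be a nonempty closed convex subset of a real Hilbert space $H$ and $T$ a $\kappa$-strict pseudo-contraction of $C$ into itself for some $0\le\kappa<1$ with $F(T)\ne\emptyset$. Let $\{\alpha_n\}_{n\ge0}$ be a real sequence with $0<\alpha\le\alpha_n\le1$ for all $n$ (for some constant $\alpha$) and $\{\beta_n\}_{n\ge0}$ a sequence in $[0,1]$. Let $x_0\in C$ be arbitrary and let $\{x_n\}$ be given, for $n\ge0$, by $$v_n=(1-\alpha_n)x_n+\alpha_nTx_n,\qquad y_n=(1-\beta_n)x_0+\beta_nTx_n,$$ $$C_n'=\{z\in C:\|v_n-z\|^2\le\|x_n-z\|^2+\alpha_n(\kappa-(1-\alpha_n))\|x_n-Tx_n\|^2\},$$ $$C_n''=\{z\in C:\|y_n-z\|^2\le\|x_n-z\|^2+2(1-\beta_n)\langle x_n-x_0,z\rangle+\theta_n\},$$ $$C_n=C_n'\cap C_n'',$$ $$Q_n=\{z\in C:\langle z-x_n,x_n-x_0\rangle\ge0\},$$ $$x_{n+1}=P_{C_n^*\cap Q_n}x_0,$$ where $C_n^*$ is a closed convex set with $F(T)\subset C_n^*\subset C_n$ and $$\theta_n=(1-\beta_n)(\|x_0\|^2-\|x_n\|^2)+\beta_n\kappa\|x_n-Tx_n\|^2-\beta_n(1-\beta_n)\|x_0-Tx_n\|^2.$$ Then $\{x_n\}$ converges strongly to $P_{F(T)}x_0$.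
   Context: $F(T)=\{x\in C:Tx=x\}$. $T$ is a $\kappa$-strict pseudo-contraction if $\|Tx-Ty\|^2\le\|x-y\|^2+\kappa\|(I-T)x-(I-T)y\|^2$ for all $x,y\in C$ ($I$ the identity). For a nonempty closed convex set $D\subset H$, $P_D$ is the metric projection (nearest-point map) onto $D$. *)

theory Defs
  imports "HOL-Analysis.Analysis"
begin

definition fixed_points :: "'a set \<Rightarrow> ('a \<Rightarrow> 'a) \<Rightarrow> 'a set" where
  "fixed_points C T = {x \<in> C. T x = x}"

definition strict_pseudo_contraction ::
    "real \<Rightarrow> 'a::real_inner set \<Rightarrow> ('a \<Rightarrow> 'a) \<Rightarrow> bool" where
  "strict_pseudo_contraction \<kappa> C T \<longleftrightarrow>
     (\<forall>x\<in>C. \<forall>y\<in>C. (norm (T x - T y))\<^sup>2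
        \<le> (norm (x - y))\<^sup>2 + \<kappa> * (norm ((x - T x) - (y - T y)))\<^sup>2)"

(* The library constant closest_point requires class heine_borel, hence finite dimension.
   The nearest point exists and is unique when D is nonempty, closed and convex in a
   Hilbert space; for other sets the value may be unspecified. *)
definition metric_projection :: "'a::real_inner set \<Rightarrow> 'a \<Rightarrow> 'a" where
  "metric_projection D x = (THE p. p \<in> D \<and> (\<forall>y\<in>D. dist x p \<le> dist x y))"

end

theory Submission
  imports Defs
begin

text \<open>
  Write \<open>A = I - T\<close>. The hypothesis on \<open>T\<close> says that \<open>A\<close> is inverse strongly monotone
  (\<open>strict_pseudo_contraction_residual\<close>), so \<open>A\<close> is monotone and Lipschitz, and its zeros are the
  fixed points of \<open>T\<close>.

  The half spaces \<open>Q n\<close> make the distances from \<open>x 0\<close> to \<open>x n\<close> increase, with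
  \<open>\<parallel>x (n+1) - x n\<parallel>\<^sup>2 \<le> \<parallel>x (n+1) - x 0\<parallel>\<^sup>2 - \<parallel>x n - x 0\<parallel>\<^sup>2\<close>. The fixed points lie in all the sets
  onto which \<open>x 0\<close> is projected, so these distances are bounded and the steps tend to \<open>0\<close>. The
  inequality that defines \<open>C' n\<close>, applied to \<open>x (n+1)\<close>, bounds the residual \<open>A (x n)\<close> by a multiple
  of the step. So \<open>x\<close> is a bounded sequence of approximate fixed points.

  The sets \<open>Cstar n \<inter> Q n\<close> need not be nested, so the increasing distances alone do not make \<open>x\<close> a
  Cauchy sequence. A strongly convergent approximation of the target takes over the part that weak
  compactness and demiclosedness of \<open>A\<close> at \<open>0\<close> usually have in such proofs. For \<open>r > 0\<close> let
  \<open>z\<close> solve \<open>A z = r (x 0 - z)\<close>; as \<open>r\<close> tends to \<open>0\<close> these points converge strongly to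
  the fixed point \<open>p\<close> nearest to \<open>x 0\<close> (\<open>fixed_point_approximation\<close>, a form of Browder's theorem).
  Monotonicity of \<open>A\<close> between \<open>x n\<close> and \<open>z\<close> gives
  \<open>r \<langle>x 0 - z, x n - z\<rangle> \<le> \<langle>A (x n), x n - z\<rangle>\<close>, whose right-hand side tends to \<open>0\<close> with \<open>n\<close>.
  Letting \<open>z\<close> tend to \<open>p\<close> yields \<open>limsup \<langle>x 0 - p, x n - p\<rangle> \<le> 0\<close>
  (\<open>approximate_fixed_points_inner\<close>). As \<open>p\<close> lies in \<open>Q n\<close>,
  \<open>\<parallel>x n - p\<parallel>\<^sup>2 \<le> \<langle>x 0 - p, x n - p\<rangle>\<close>, and strong convergence follows.
\<close>

section \<open>Metric projections in Hilbert spaces\<close>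

lemma Cauchy_if_dist_square_le:
  fixes u :: "nat \<Rightarrow> 'a::metric_space"
  assumes le: "\<And>m n. m \<le> n \<Longrightarrow> (dist (u m) (u n))\<^sup>2 \<le> f m + f n"
    and lim: "f \<longlonglongrightarrow> (0::real)"
  shows "Cauchy u"
proof (rule metric_CauchyI)
  fix e :: real assume e: "e > 0"
  then have "e\<^sup>2 / 2 > 0" by simp
  from order_tendstoD(2)[OF lim this] obtain N where N: "\<And>n. n \<ge> N \<Longrightarrow> f n < e\<^sup>2 / 2"
    by (auto simp: eventually_sequentially)
  have sym: "(dist (u m) (u n))\<^sup>2 \<le> f m + f n" for m n
    using le[of m n] le[of n m] by (cases "m \<le> n") (auto simp: dist_commute)
  have "dist (u m) (u n) < e" if "m \<ge> N" "n \<ge> N" for m n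
  proof -
    have "(dist (u m) (u n))\<^sup>2 < e\<^sup>2"
      using sym[of m n] N[OF that(1)] N[OF that(2)] by linarith
    then show ?thesis using e power_less_imp_less_base[of "dist (u m) (u n)" 2 e] by simp
  qed
  then show "\<exists>M. \<forall>m\<ge>M. \<forall>n\<ge>M. dist (u m) (u n) < e" by blast
qed

text \<open>By the parallelogram law, a midpoint would be too close to \<open>x\<close> if two almost nearest points
  were far apart; so a minimizing sequence is Cauchy.\<close>

lemma nearest_point_exists:
  fixes D :: "'a::{real_inner, complete_space} set"
  assumes "D \<noteq> {}" "closed D" "convex D"
  shows "\<exists>p\<in>D. \<forall>y\<in>D. dist x p \<le> dist x y"
proof -
  define s where "s = (INF z\<in>D. (dist x z)\<^sup>2)"
  have bdd: "bdd_below ((\<lambda>z. (dist x z)\<^sup>2) ` D)"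
    by (rule bdd_belowI[of _ 0]) auto
  have s_le: "s \<le> (dist x z)\<^sup>2" if "z \<in> D" for z
    unfolding s_def using bdd that by (rule cINF_lower)
  have "\<exists>z\<in>D. (dist x z)\<^sup>2 < s + 1 / real (Suc n)" for n
    using cINF_less_iff[OF assms(1) bdd, of "s + 1 / real (Suc n)"] by (simp add: s_def)
  then obtain u where uD: "\<And>n. u n \<in> D"
    and u: "\<And>n. (dist x (u n))\<^sup>2 < s + 1 / real (Suc n)" by metis
  have inv: "(\<lambda>n. 1 / real (Suc n)) \<longlonglongrightarrow> 0"
    using LIMSEQ_inverse_real_of_nat by (simp add: inverse_eq_divide)
  have "Cauchy u"
  proof (rule Cauchy_if_dist_square_le)
    fix m n :: nat
    have "(1/2) *\<^sub>R u m + (1/2) *\<^sub>R u n \<in> D"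
      by (rule convexD[OF assms(3) uD uD]) auto
    note s_le[OF this]
    moreover have "(dist x ((1/2) *\<^sub>R u m + (1/2) *\<^sub>R u n))\<^sup>2
        = (dist x (u m))\<^sup>2 / 2 + (dist x (u n))\<^sup>2 / 2 - (dist (u m) (u n))\<^sup>2 / 4"
      unfolding dist_norm power2_norm_eq_inner
      by (simp add: inner_diff inner_add inner_commute field_simps)
    ultimately show "(dist (u m) (u n))\<^sup>2 \<le> 2 * (1 / real (Suc m)) + 2 * (1 / real (Suc n))"
      using u[of m] u[of n] by linarith
  next
    show "(\<lambda>n. 2 * (1 / real (Suc n))) \<longlonglongrightarrow> 0"
      using tendsto_mult_right_zero[OF inv, of 2] .
  qed
  then obtain p where p: "u \<longlonglongrightarrow> p" using Cauchy_convergent convergent_def by blast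
  have "p \<in> D" using assms(2) uD p closed_sequentially by blast
  moreover have "(dist x p)\<^sup>2 \<le> s"
  proof (rule LIMSEQ_le)
    show "(\<lambda>n. (dist x (u n))\<^sup>2) \<longlonglongrightarrow> (dist x p)\<^sup>2" by (intro tendsto_intros p)
    show "(\<lambda>n. s + 1 / real (Suc n)) \<longlonglongrightarrow> s"
      using tendsto_add[OF tendsto_const inv, of s] by simp
    show "\<exists>N. \<forall>n\<ge>N. (dist x (u n))\<^sup>2 \<le> s + 1 / real (Suc n)" using u less_imp_le by blast
  qed
  ultimately show ?thesis using s_le by (meson order_trans power2_le_imp_le zero_le_dist)
qed

lemma metric_projection:
  fixes D :: "'a::{real_inner, complete_space} set"
  assumes "D \<noteq> {}" "closed D" "convex D"
  shows metric_projection_mem: "metric_projection D x \<in> D"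
    and metric_projection_inner: "z \<in> D \<Longrightarrow>
      (x - metric_projection D x) \<bullet> (z - metric_projection D x) \<le> 0"
proof -
  have "\<exists>!p. p \<in> D \<and> (\<forall>y\<in>D. dist x p \<le> dist x y)"
    using nearest_point_exists[OF assms, of x] any_closest_point_unique[OF assms(3,2)] by blast
  from theI'[OF this]
  have p: "metric_projection D x \<in> D" "\<forall>y\<in>D. dist x (metric_projection D x) \<le> dist x y"
    by (simp_all add: metric_projection_def)
  show "metric_projection D x \<in> D" by (rule p)
  show "(x - metric_projection D x) \<bullet> (z - metric_projection D x) \<le> 0" if "z \<in> D"
    by (rule any_closest_point_dot[OF assms(3,2) p(1) that p(2)])
qed

text \<open>By Pythagoras the variational inequality gives
  \<open>\<parallel>x - p\<parallel>\<^sup>2 + \<parallel>p - z\<parallel>\<^sup>2 \<le> \<parallel>x - z\<parallel>\<^sup>2\<close>, which makes \<open>p\<close> nearest and unique in any set \<open>D\<close>; in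
  this form the projection onto the set of fixed points is recognized.\<close>

lemma metric_projection_eqI:
  assumes "p \<in> D" and vi: "\<And>z. z \<in> D \<Longrightarrow> (x - p) \<bullet> (z - p) \<le> 0"
  shows "metric_projection D x = p"
proof -
  have sq: "(dist x p)\<^sup>2 + (dist p z)\<^sup>2 \<le> (dist x z)\<^sup>2" if "z \<in> D" for z
    using vi[OF that] unfolding dist_norm power2_norm_eq_inner
    by (simp add: inner_diff inner_commute)
  show ?thesis
    unfolding metric_projection_def
  proof (rule the_equality)
    have "dist x p \<le> dist x z" if "z \<in> D" for z
      by (rule power2_le_imp_le)
        (use sq[OF that] zero_le_power2[of "dist p z"] in linarith, simp)
    then show "p \<in> D \<and> (\<forall>z\<in>D. dist x p \<le> dist x z)" using assms(1) by blast
  next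
    fix q assume q: "q \<in> D \<and> (\<forall>z\<in>D. dist x q \<le> dist x z)"
    then have "(dist x q)\<^sup>2 \<le> (dist x p)\<^sup>2" using assms(1) by (intro power_mono) auto
    then have "(dist p q)\<^sup>2 \<le> 0" using sq[of q] q by linarith
    then show "q = p" by simp
  qed
qed

section \<open>The residual of a strict pseudo-contraction\<close>

lemma strict_pseudo_contraction_residual:
  assumes "strict_pseudo_contraction \<kappa> C T" "x \<in> C" "y \<in> C"
  shows "(1 - \<kappa>) / 2 * (norm ((x - T x) - (y - T y)))\<^sup>2 \<le> (x - y) \<bullet> ((x - T x) - (y - T y))"
proof -
  define a where "a = (x - T x) - (y - T y)"
  have "(norm (T x - T y))\<^sup>2 \<le> (norm (x - y))\<^sup>2 + \<kappa> * (norm a)\<^sup>2"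
    using assms by (simp add: strict_pseudo_contraction_def a_def)
  moreover have "T x - T y = (x - y) - a" by (simp add: a_def)
  ultimately have "(1 - \<kappa>) * (norm a)\<^sup>2 \<le> 2 * ((x - y) \<bullet> a)"
    using dot_norm_neg[of "x - y" a] by (simp add: left_diff_distrib)
  then show ?thesis by (simp add: a_def)
qed

lemma strict_pseudo_contraction_residual_monotone:
  assumes "strict_pseudo_contraction \<kappa> C T" "\<kappa> < 1" "x \<in> C" "y \<in> C"
  shows "0 \<le> (x - y) \<bullet> ((x - T x) - (y - T y))"
proof -
  have "0 \<le> (1 - \<kappa>) / 2 * (norm ((x - T x) - (y - T y)))\<^sup>2" using assms(2) by simp
  then show ?thesis using strict_pseudo_contraction_residual[OF assms(1,3,4)] by linarith
qed

lemma strict_pseudo_contraction_residual_Lipschitz: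
  assumes "strict_pseudo_contraction \<kappa> C T" "\<kappa> < 1" "x \<in> C" "y \<in> C"
  shows "norm ((x - T x) - (y - T y)) \<le> 2 / (1 - \<kappa>) * norm (x - y)"
proof -
  let ?w = "norm ((x - T x) - (y - T y))"
  have "(1 - \<kappa>) / 2 * ?w\<^sup>2 \<le> norm (x - y) * ?w"
    using strict_pseudo_contraction_residual[OF assms(1,3,4)]
      norm_cauchy_schwarz[of "x - y" "(x - T x) - (y - T y)"] by linarith
  then have "((1 - \<kappa>) / 2 * ?w) * ?w \<le> norm (x - y) * ?w" by (simp add: power2_eq_square)
  then have "(1 - \<kappa>) / 2 * ?w \<le> norm (x - y)"
    by (cases "?w = 0") (auto dest: mult_right_le_imp_le)
  then show ?thesis using assms(2) by (simp add: field_simps)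
qed

text \<open>The averaged map \<open>I - (1 - \<kappa>) (I - T)\<close> is nonexpansive and has the fixed points of \<open>T\<close>. A
  convex combination with the constant map \<open>c\<close> turns it into a strict contraction of \<open>C\<close>, whose fixed
  point is the required \<open>z\<close>.\<close>

lemma resolvent_point_exists:
  fixes C :: "'a::{real_inner, complete_space} set"
  assumes C: "closed C" "convex C" "T ` C \<subseteq> C"
    and T: "strict_pseudo_contraction \<kappa> C T" "0 \<le> \<kappa>" "\<kappa> < 1"
    and c: "c \<in> C" and r: "r > 0"
  shows "\<exists>z\<in>C. z - T z = r *\<^sub>R (c - z)"
proof -
  define l where "l = 1 - \<kappa>"
  have l: "0 < l" "l \<le> 1" using T by (auto simp: l_def)
  define S where "S z = z - l *\<^sub>R (z - T z)" for z
  \<comment> \<open>With this weight the fixed point equation becomes \<open>z - T z = r (c - z)\<close>.\<close>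
  define t where "t = 1 / (1 + r * l)"
  have rl: "r * l > 0" using r l by simp
  then have t: "0 < t" "t < 1" by (auto simp: t_def)
  define f where "f z = (1 - t) *\<^sub>R c + t *\<^sub>R S z" for z
  have S_mem: "S z \<in> C" if "z \<in> C" for z
  proof -
    have "(1 - l) *\<^sub>R z + l *\<^sub>R T z \<in> C"
      using C that l by (intro convexD) auto
    then show ?thesis by (simp add: S_def algebra_simps)
  qed
  have S_nonexp: "norm (S z - S w) \<le> norm (z - w)" if "z \<in> C" "w \<in> C" for z w
  proof (rule power2_le_imp_le)
    define a where "a = (z - T z) - (w - T w)"
    have "S z - S w = (z - w) - l *\<^sub>R a" by (simp add: S_def a_def algebra_simps)
    then have "(norm (S z - S w))\<^sup>2 = (norm (z - w))\<^sup>2 - 2 * l * ((z - w) \<bullet> a) + l\<^sup>2 * (norm a)\<^sup>2"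
      using dot_norm_neg[of "z - w" "l *\<^sub>R a"] by (simp add: power_mult_distrib)
    moreover have "2 * l * (l / 2 * (norm a)\<^sup>2) \<le> 2 * l * ((z - w) \<bullet> a)"
      using strict_pseudo_contraction_residual[OF T(1) that] l
      by (intro mult_left_mono) (auto simp: a_def l_def)
    ultimately show "(norm (S z - S w))\<^sup>2 \<le> (norm (z - w))\<^sup>2" by (simp add: power2_eq_square)
  qed simp
  have "\<exists>!z\<in>C. f z = z"
  proof (rule Banach_fix)
    show "complete C" using C by (simp add: complete_eq_closed)
    show "C \<noteq> {}" using c by auto
    show "0 \<le> t" "t < 1" using t by auto
    have "f z \<in> C" if "z \<in> C" for z
      unfolding f_def by (rule convexD[OF C(2) c S_mem[OF that]]) (use t in auto)
    then show "f ` C \<subseteq> C" by blast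
    show "dist (f z) (f w) \<le> t * dist z w" if "z \<in> C" "w \<in> C" for z w
    proof -
      have "f z - f w = t *\<^sub>R (S z - S w)" by (simp add: f_def algebra_simps)
      then have "dist (f z) (f w) = t * norm (S z - S w)" using t by (simp add: dist_norm)
      also have "\<dots> \<le> t * dist z w"
        using S_nonexp[OF that] t by (simp add: dist_norm)
      finally show ?thesis .
    qed
  qed
  then obtain z where z: "z \<in> C" "f z = z" by blast
  have "(1 + r * l) *\<^sub>R f z = (r * l) *\<^sub>R c + S z"
  proof -
    have "(1 + r * l) * t = 1" "(1 + r * l) * (1 - t) = r * l"
      using rl by (auto simp: t_def field_simps)
    then show ?thesis by (simp add: f_def scaleR_add_right)
  qed
  then have "l *\<^sub>R (z - T z) = l *\<^sub>R (r *\<^sub>R (c - z))"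
    using z(2) by (simp add: S_def algebra_simps)
  then have "z - T z = r *\<^sub>R (c - z)" using l(1) by (simp only: scaleR_cancel_left) simp
  then show ?thesis using z(1) by blast
qed

section \<open>Strong approximation of the nearest fixed point\<close>

text \<open>Monotonicity of the residual between two resolvent points reads
  \<open>\<langle>r (z - c) - s (w - c), z - w\<rangle> \<le> 0\<close>. So for \<open>s < r\<close> the vector \<open>z - c\<close> is at most as long as
  \<open>w - c\<close> and the square of \<open>\<parallel>z - w\<parallel>\<close> is at most the gain in squared length. The case \<open>s = 0\<close> is
  the comparison with a fixed point \<open>w\<close>.\<close>

lemma resolvent_points_inner:
  assumes T: "strict_pseudo_contraction \<kappa> C T" "\<kappa> < 1"
    and z: "z \<in> C" "z - T z = r *\<^sub>R (c - z)"
    and w: "w \<in> C" "w - T w = s *\<^sub>R (c - w)"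
    and rs: "0 \<le> s" "s < r"
  shows "(z - c) \<bullet> (z - w) \<le> 0"
proof -
  have "0 \<le> (z - w) \<bullet> (r *\<^sub>R (c - z) - s *\<^sub>R (c - w))"
    using strict_pseudo_contraction_residual_monotone[OF T z(1) w(1)] z(2) w(2) by simp
  also have "r *\<^sub>R (c - z) - s *\<^sub>R (c - w) = - ((r - s) *\<^sub>R (z - c)) - s *\<^sub>R (z - w)"
    by (simp add: algebra_simps)
  also have "(z - w) \<bullet> \<dots> = - (r - s) * ((z - c) \<bullet> (z - w)) - s * (norm (z - w))\<^sup>2"
    by (simp add: inner_diff power2_norm_eq_inner inner_commute) (simp add: algebra_simps)
  finally have "(r - s) * ((z - c) \<bullet> (z - w)) \<le> - (s * (norm (z - w))\<^sup>2)"
    by (simp add: left_diff_distrib)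
  also have "\<dots> \<le> 0" using rs by simp
  finally show ?thesis using rs by (simp add: mult_le_0_iff)
qed

lemma resolvent_points_dist_square:
  assumes "strict_pseudo_contraction \<kappa> C T" "\<kappa> < 1"
    and "z \<in> C" "z - T z = r *\<^sub>R (c - z)"
    and "w \<in> C" "w - T w = s *\<^sub>R (c - w)"
    and "0 \<le> s" "s < r"
  shows "(dist z w)\<^sup>2 \<le> (norm (w - c))\<^sup>2 - (norm (z - c))\<^sup>2"
proof -
  have "(norm (w - c))\<^sup>2 = (norm (z - c))\<^sup>2 + (dist z w)\<^sup>2 - 2 * ((z - c) \<bullet> (z - w))"
    unfolding dist_norm power2_norm_eq_inner by (simp add: inner_diff inner_commute)
  then show ?thesis using resolvent_points_inner[OF assms] by linarith
qed

text \<open>Along \<open>r n = 1 / (n + 1)\<close> the squared lengths \<open>\<parallel>z n - c\<parallel>\<^sup>2\<close> increase and are bounded by the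
  squared distance from \<open>c\<close> to any fixed point, so the resolvent points form a Cauchy sequence. Their residuals
  \<open>r n (c - z n)\<close> tend to \<open>0\<close>, hence the limit \<open>p\<close> is a fixed point, and the comparison with fixed
  points passes to the limit as the variational inequality.\<close>

lemma fixed_point_approximation:
  fixes C :: "'a::{real_inner, complete_space} set"
  assumes C: "closed C" "convex C" "T ` C \<subseteq> C"
    and T: "strict_pseudo_contraction \<kappa> C T" "0 \<le> \<kappa>" "\<kappa> < 1"
    and F: "fixed_points C T \<noteq> {}" and c: "c \<in> C"
  obtains p where "p \<in> fixed_points C T"
    and "\<And>q. q \<in> fixed_points C T \<Longrightarrow> (c - p) \<bullet> (q - p) \<le> 0"
    and "\<And>e. e > 0 \<Longrightarrow> \<exists>r>0. \<exists>z\<in>C. z - T z = r *\<^sub>R (c - z) \<and> dist z p < e"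
proof -
  define r where "r n = 1 / real (Suc n)" for n
  have r_pos: "r n > 0" for n by (simp add: r_def)
  have r_lim: "r \<longlonglongrightarrow> 0"
    unfolding r_def using LIMSEQ_inverse_real_of_nat by (simp add: inverse_eq_divide)
  have "\<exists>z\<in>C. z - T z = r n *\<^sub>R (c - z)" for n
    by (rule resolvent_point_exists[OF C T c r_pos])
  then obtain z where zC: "\<And>n. z n \<in> C" and z: "\<And>n. z n - T (z n) = r n *\<^sub>R (c - z n)"
    by metis
  have z_dist: "(dist (z m) (z n))\<^sup>2 \<le> (norm (z n - c))\<^sup>2 - (norm (z m - c))\<^sup>2" if "m \<le> n" for m n
  proof (cases "m = n")
    case False
    then have "r n < r m" using that by (auto simp: r_def frac_less2)
    then show ?thesis
      using resolvent_points_dist_square[OF T(1,3) zC z zC z] r_pos less_imp_le by blast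
  qed simp
  have z_fix: "(z n - c) \<bullet> (z n - q) \<le> 0" and z_bd: "(norm (z n - c))\<^sup>2 \<le> (norm (q - c))\<^sup>2"
    if "q \<in> fixed_points C T" for n q
  proof -
    have q: "q \<in> C" "q - T q = 0 *\<^sub>R (c - q)" using that by (auto simp: fixed_points_def)
    show "(z n - c) \<bullet> (z n - q) \<le> 0"
      by (rule resolvent_points_inner[OF T(1,3) zC z q order_refl r_pos])
    have "(dist (z n) q)\<^sup>2 \<le> (norm (q - c))\<^sup>2 - (norm (z n - c))\<^sup>2"
      by (rule resolvent_points_dist_square[OF T(1,3) zC z q order_refl r_pos])
    then show "(norm (z n - c))\<^sup>2 \<le> (norm (q - c))\<^sup>2"
      using zero_le_power2[of "dist (z n) q"] by linarith
  qed
  obtain q0 where q0: "q0 \<in> fixed_points C T" using F by blast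
  have "incseq (\<lambda>n. (norm (z n - c))\<^sup>2)"
  proof (rule incseq_SucI)
    fix n show "(norm (z n - c))\<^sup>2 \<le> (norm (z (Suc n) - c))\<^sup>2"
      using z_dist[of n "Suc n"] zero_le_power2[of "dist (z n) (z (Suc n))"] by linarith
  qed
  then obtain L where L: "(\<lambda>n. (norm (z n - c))\<^sup>2) \<longlonglongrightarrow> L"
    using incseq_convergent[of "\<lambda>n. (norm (z n - c))\<^sup>2"] z_bd[OF q0] by blast
  have "Cauchy z"
  proof (rule Cauchy_if_dist_square_le)
    show "(dist (z m) (z n))\<^sup>2 \<le> \<bar>(norm (z m - c))\<^sup>2 - L\<bar> + \<bar>(norm (z n - c))\<^sup>2 - L\<bar>"
      if "m \<le> n" for m n using z_dist[OF that] by linarith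
    show "(\<lambda>n. \<bar>(norm (z n - c))\<^sup>2 - L\<bar>) \<longlonglongrightarrow> 0"
      using L by (simp add: LIM_zero tendsto_rabs_zero)
  qed
  then obtain p where p: "z \<longlonglongrightarrow> p" using Cauchy_convergent convergent_def by blast
  have pC: "p \<in> C" using C(1) zC p closed_sequentially by blast
  have "(\<lambda>n. z n - T (z n)) \<longlonglongrightarrow> p - T p"
  proof (rule LIM_zero_cancel, rule tendsto_norm_zero_cancel, rule tendsto_sandwich)
    show "\<forall>\<^sub>F n in sequentially. 0 \<le> norm (z n - T (z n) - (p - T p))" by simp
    show "\<forall>\<^sub>F n in sequentially.
        norm (z n - T (z n) - (p - T p)) \<le> 2 / (1 - \<kappa>) * norm (z n - p)"
      using strict_pseudo_contraction_residual_Lipschitz[OF T(1,3) zC pC] by simp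
    show "(\<lambda>n. 2 / (1 - \<kappa>) * norm (z n - p)) \<longlonglongrightarrow> 0"
      by (intro tendsto_mult_right_zero tendsto_norm_zero LIM_zero p)
  qed simp
  moreover have "(\<lambda>n. z n - T (z n)) \<longlonglongrightarrow> 0"
  proof -
    have "(\<lambda>n. r n *\<^sub>R (c - z n)) \<longlonglongrightarrow> 0 *\<^sub>R (c - p)" by (intro tendsto_intros r_lim p)
    then show ?thesis by (simp add: z)
  qed
  ultimately have "p - T p = 0" by (rule LIMSEQ_unique)
  then have pF: "p \<in> fixed_points C T" using pC by (simp add: fixed_points_def)
  show thesis
  proof (rule that[OF pF])
    show "(c - p) \<bullet> (q - p) \<le> 0" if "q \<in> fixed_points C T" for q
    proof -
      have "(\<lambda>n. (z n - c) \<bullet> (z n - q)) \<longlonglongrightarrow> (p - c) \<bullet> (p - q)" by (intro tendsto_intros p)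
      then have "(p - c) \<bullet> (p - q) \<le> 0"
        by (rule LIMSEQ_le_const2) (use z_fix[OF that] in blast)
      then show ?thesis by (simp add: inner_diff)
    qed
    show "\<exists>r>0. \<exists>z\<in>C. z - T z = r *\<^sub>R (c - z) \<and> dist z p < e" if "e > 0" for e
      using metric_LIMSEQ_D[OF p that] zC z r_pos by blast
  qed
qed

text \<open>Monotonicity of the residual between \<open>x n\<close> and a resolvent point \<open>z\<close> bounds
  \<open>r \<langle>c - z, x n - z\<rangle>\<close> by a product that tends to \<open>0\<close>; a \<open>z\<close> close to \<open>p\<close> then gives the claim. This
  takes the place of the demiclosedness of the residual at \<open>0\<close>.\<close>

lemma approximate_fixed_points_inner:
  fixes x :: "nat \<Rightarrow> 'a::real_inner"
  assumes T: "strict_pseudo_contraction \<kappa> C T" "\<kappa> < 1"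
    and appr: "\<And>e. e > 0 \<Longrightarrow> \<exists>r>0. \<exists>z\<in>C. z - T z = r *\<^sub>R (c - z) \<and> dist z p < e"
    and x: "\<And>n. x n \<in> C" "\<And>n. norm (x n - p) \<le> B"
    and res: "(\<lambda>n. x n - T (x n)) \<longlonglongrightarrow> 0"
    and e: "e > 0"
  shows "\<forall>\<^sub>F n in sequentially. (c - p) \<bullet> (x n - p) < e"
proof -
  have B: "B \<ge> 0" using x(2)[of 0] norm_ge_zero order_trans by blast
  define K where "K = B + 1 + norm (c - p)"
  have K: "K > 0" using B by (simp add: K_def add_nonneg_pos add_pos_nonneg)
  define d where "d = min 1 (e / (2 * K))"
  have d: "d > 0" "d \<le> 1" "d * K \<le> e / 2"
    using e K by (auto simp: d_def min_def field_simps)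
  obtain r z where r: "r > 0" and z: "z \<in> C" "z - T z = r *\<^sub>R (c - z)" "dist z p < d"
    using appr[OF d(1)] by blast
  have zp: "norm (z - p) \<le> d" using z(3) by (simp add: dist_norm)
  have xz: "norm (x n - z) \<le> B + 1" for n
    using norm_triangle_ineq4[of "x n - p" "z - p"] x(2)[of n] zp d(2) by simp
  have mono: "r * ((c - z) \<bullet> (x n - z)) \<le> norm (x n - T (x n)) * (B + 1)" for n
  proof -
    have "r * ((c - z) \<bullet> (x n - z)) \<le> (x n - z) \<bullet> (x n - T (x n))"
      using strict_pseudo_contraction_residual_monotone[OF T x(1)[of n] z(1)] z(2)
      by (simp add: inner_diff_right inner_commute)
    also have "\<dots> \<le> norm (x n - z) * norm (x n - T (x n))" by (rule norm_cauchy_schwarz)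
    also have "\<dots> \<le> (B + 1) * norm (x n - T (x n))" using xz by (rule mult_right_mono) simp
    finally show ?thesis by (simp add: mult.commute)
  qed
  have bound: "(c - p) \<bullet> (x n - p) \<le> norm (x n - T (x n)) * (B + 1) / r + e / 2" for n
  proof -
    have "(c - p) \<bullet> (x n - p)
        = (c - z) \<bullet> (x n - z) + (z - p) \<bullet> (x n - z) + (z - p) \<bullet> (c - p)"
      by (simp add: inner_diff inner_commute)
    moreover have "(c - z) \<bullet> (x n - z) \<le> norm (x n - T (x n)) * (B + 1) / r"
      using mono[of n] r by (simp add: pos_le_divide_eq mult.commute)
    moreover have "(z - p) \<bullet> (x n - z) \<le> d * (B + 1)"
      using norm_cauchy_schwarz[of "z - p" "x n - z"] mult_mono[OF zp xz[of n]] d by simp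
    moreover have "(z - p) \<bullet> (c - p) \<le> d * norm (c - p)"
      using norm_cauchy_schwarz[of "z - p" "c - p"] mult_right_mono[OF zp, of "norm (c - p)"]
      by simp
    ultimately show ?thesis using d(3) by (simp add: K_def algebra_simps)
  qed
  have "(\<lambda>n. norm (x n - T (x n)) * (B + 1) / r) \<longlonglongrightarrow> 0 * (B + 1) / r"
    using r by (intro tendsto_intros tendsto_norm_zero res) auto
  then have "\<forall>\<^sub>F n in sequentially. norm (x n - T (x n)) * (B + 1) / r < e / 2"
    by (rule order_tendstoD(2)) (use e in simp)
  then show ?thesis by eventually_elim (use bound in \<open>smt (verit) field_sum_of_halves\<close>)
qed

section \<open>Convergence of the hybrid iteration\<close>

text \<open>The inequality is the one that defines \<open>C' n\<close>, at \<open>z = x (n+1)\<close>: after expanding its left-hand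
  side, the terms quadratic in \<open>\<alpha>\<close> cancel, and so does the factor \<open>\<alpha>\<close>.\<close>

lemma residual_le_step:
  fixes u w Tu :: "'a::real_inner"
  assumes "\<alpha> > 0" "\<kappa> < 1"
    and le: "(norm ((1 - \<alpha>) *\<^sub>R u + \<alpha> *\<^sub>R Tu - w))\<^sup>2
      \<le> (norm (u - w))\<^sup>2 + \<alpha> * (\<kappa> - (1 - \<alpha>)) * (norm (u - Tu))\<^sup>2"
  shows "norm (u - Tu) \<le> 2 / (1 - \<kappa>) * norm (u - w)"
proof -
  define g where "g = u - w"
  define h where "h = u - Tu"
  have "(1 - \<alpha>) *\<^sub>R u + \<alpha> *\<^sub>R Tu - w = g - \<alpha> *\<^sub>R h" by (simp add: g_def h_def algebra_simps)
  then have "(norm (g - \<alpha> *\<^sub>R h))\<^sup>2 \<le> (norm g)\<^sup>2 + \<alpha> * (\<kappa> - (1 - \<alpha>)) * (norm h)\<^sup>2"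
    using le by (simp only: g_def h_def)
  moreover have "(norm (g - \<alpha> *\<^sub>R h))\<^sup>2 = (norm g)\<^sup>2 - 2 * \<alpha> * (g \<bullet> h) + \<alpha>\<^sup>2 * (norm h)\<^sup>2"
    using dot_norm_neg[of g "\<alpha> *\<^sub>R h"] by (simp add: power_mult_distrib)
  ultimately have "\<alpha> * ((1 - \<kappa>) * (norm h)\<^sup>2) \<le> \<alpha> * (2 * (g \<bullet> h))"
    by (simp add: algebra_simps power2_eq_square)
  then have "(1 - \<kappa>) * (norm h)\<^sup>2 \<le> 2 * (g \<bullet> h)" using assms(1) by simp
  also have "\<dots> \<le> 2 * (norm g * norm h)" using norm_cauchy_schwarz[of g h] by simp
  finally have "((1 - \<kappa>) * norm h) * norm h \<le> (2 * norm g) * norm h"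
    by (simp add: power2_eq_square)
  then have "(1 - \<kappa>) * norm h \<le> 2 * norm g"
    by (cases "h = 0") (auto dest: mult_right_le_imp_le)
  then show ?thesis using assms(2) by (simp add: g_def h_def field_simps)
qed

theorem theorem7p3:
  fixes C :: "'a::{real_inner, complete_space} set"
    and T :: "'a \<Rightarrow> 'a"
    and \<kappa> a :: real
    and \<alpha> \<beta> \<theta> :: "nat \<Rightarrow> real"
    and x v y :: "nat \<Rightarrow> 'a"
    and C' C'' Cn Cstar Q :: "nat \<Rightarrow> 'a set"
  assumes "C \<noteq> {}" and "closed C" and "convex C"
    and "T ` C \<subseteq> C"
    and "0 \<le> \<kappa>" and "\<kappa> < 1"
    and "strict_pseudo_contraction \<kappa> C T"
    and "fixed_points C T \<noteq> {}"
    and "0 < a" and "\<And>n. a \<le> \<alpha> n" and "\<And>n. \<alpha> n \<le> 1"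
    and "\<And>n. \<beta> n \<in> {0..1}"
    and "x 0 \<in> C"
    and "\<And>n. v n = (1 - \<alpha> n) *\<^sub>R x n + \<alpha> n *\<^sub>R T (x n)"
    and "\<And>n. y n = (1 - \<beta> n) *\<^sub>R x 0 + \<beta> n *\<^sub>R T (x n)"
    and "\<And>n. C' n = {z \<in> C. (norm (v n - z))\<^sup>2 \<le> (norm (x n - z))\<^sup>2
            + \<alpha> n * (\<kappa> - (1 - \<alpha> n)) * (norm (x n - T (x n)))\<^sup>2}"
    and "\<And>n. C'' n = {z \<in> C. (norm (y n - z))\<^sup>2 \<le> (norm (x n - z))\<^sup>2
            + 2 * (1 - \<beta> n) * ((x n - x 0) \<bullet> z) + \<theta> n}"
    and "\<And>n. Cn n = C' n \<inter> C'' n"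
    and "\<And>n. Q n = {z \<in> C. (z - x n) \<bullet> (x n - x 0) \<ge> 0}"
    and "\<And>n. closed (Cstar n)" and "\<And>n. convex (Cstar n)"
    and "\<And>n. fixed_points C T \<subseteq> Cstar n" and "\<And>n. Cstar n \<subseteq> Cn n"
    and "\<And>n. x (Suc n) = metric_projection (Cstar n \<inter> Q n) (x 0)"
    and "\<And>n. \<theta> n = (1 - \<beta> n) * ((norm (x 0))\<^sup>2 - (norm (x n))\<^sup>2)
            + \<beta> n * \<kappa> * (norm (x n - T (x n)))\<^sup>2
            - \<beta> n * (1 - \<beta> n) * (norm (x 0 - T (x n)))\<^sup>2"
  shows "x \<longlonglongrightarrow> metric_projection (fixed_points C T) (x 0)"
proof -
  note closC = assms(2) and convC = assms(3) and TC = assms(4) and k = assms(5,6)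
    and spc = assms(7) and F = assms(8) and a = assms(9,10) and x0 = assms(13)
    and v = assms(14) and C'_def = assms(16) and Cn_def = assms(18) and Q_def = assms(19)
    and Cstar = assms(20-23) and step = assms(24)
  let ?F = "fixed_points C T"
  define D where "D n = Cstar n \<inter> Q n" for n
  have Q_eq: "Q n = C \<inter> {z. (x n - x 0) \<bullet> z \<ge> (x n - x 0) \<bullet> x n}" for n
    unfolding Q_def by (auto simp: inner_diff inner_commute)
  have closD: "closed (D n)" for n
    unfolding D_def Q_eq by (intro closed_Int Cstar(1) closC closed_halfspace_ge)
  have convD: "convex (D n)" for n
    unfolding D_def Q_eq by (intro convex_Int Cstar(2) convC convex_halfspace_ge)
  have FC: "?F \<subseteq> C" by (auto simp: fixed_points_def)
  \<comment> \<open>The variational inequality for \<open>x (n+1)\<close> on \<open>D n\<close> says that \<open>D n\<close> lies in the next half space.\<close>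
  have inv: "x n \<in> C \<and> ?F \<subseteq> Q n" for n
  proof (induction n)
    case 0
    show ?case using x0 FC by (auto simp: Q_def)
  next
    case (Suc n)
    then have FD: "?F \<subseteq> D n" using Cstar(3) by (auto simp: D_def)
    then have ne: "D n \<noteq> {}" using F by blast
    have eq: "x (Suc n) = metric_projection (D n) (x 0)" using step by (simp add: D_def)
    have "x (Suc n) \<in> D n"
      using metric_projection_mem[OF ne closD convD] eq by simp
    moreover have "(z - x (Suc n)) \<bullet> (x (Suc n) - x 0) \<ge> 0" if "z \<in> ?F" for z
    proof -
      have "(x 0 - x (Suc n)) \<bullet> (z - x (Suc n)) \<le> 0"
        using metric_projection_inner[OF ne closD convD] FD that eq by auto
      then show ?thesis by (simp add: inner_diff inner_commute)
    qed
    ultimately show ?case using FC by (auto simp: D_def Q_def)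
  qed
  have xC: "x n \<in> C" and FQ: "?F \<subseteq> Q n" for n using inv by auto
  have xD: "x (Suc n) \<in> D n" for n
  proof -
    have "D n \<noteq> {}" using F FQ[of n] Cstar(3)[of n] by (auto simp: D_def)
    then show ?thesis using metric_projection_mem[OF _ closD convD] step[of n] by (simp add: D_def)
  qed
  have Q_pyth: "(norm (z - x n))\<^sup>2 \<le> (norm (z - x 0))\<^sup>2 - (norm (x n - x 0))\<^sup>2" if "z \<in> Q n" for z n
    using that unfolding Q_def power2_norm_eq_inner by (simp add: inner_diff inner_commute)

  have steps: "(\<lambda>n. norm (x n - x (Suc n))) \<longlonglongrightarrow> 0"
  proof -
    let ?d = "\<lambda>n. (norm (x n - x 0))\<^sup>2"
    have sq: "(norm (x n - x (Suc n)))\<^sup>2 \<le> ?d (Suc n) - ?d n" for n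
      using Q_pyth[of "x (Suc n)" n] xD[of n] by (simp add: D_def norm_minus_commute)
    have "incseq ?d"
    proof (rule incseq_SucI)
      show "?d n \<le> ?d (Suc n)" for n
        using sq[of n] zero_le_power2[of "norm (x n - x (Suc n))"] by linarith
    qed
    moreover obtain q where q: "q \<in> ?F" using F by blast
    have "?d n \<le> (norm (q - x 0))\<^sup>2" for n
      using Q_pyth[of q n] FQ q zero_le_power2[of "norm (q - x n)"] by (smt (verit) subsetD)
    ultimately obtain L where L: "?d \<longlonglongrightarrow> L"
      using incseq_convergent[of ?d] by blast
    have "(\<lambda>n. ?d (Suc n) - ?d n) \<longlonglongrightarrow> L - L" by (intro tendsto_diff LIMSEQ_Suc L)
    then have "(\<lambda>n. ?d (Suc n) - ?d n) \<longlonglongrightarrow> 0" by simp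
    then have "(\<lambda>n. (norm (x n - x (Suc n)))\<^sup>2) \<longlonglongrightarrow> 0"
      by (rule tendsto_sandwich[OF _ _ tendsto_const, rotated 2]) (use sq in auto)
    then show ?thesis by simp
  qed

  have res: "(\<lambda>n. x n - T (x n)) \<longlonglongrightarrow> 0"
  proof (rule tendsto_norm_zero_cancel, rule tendsto_sandwich[OF _ _ tendsto_const])
    have "norm (x n - T (x n)) \<le> 2 / (1 - \<kappa>) * norm (x n - x (Suc n))" for n
    proof (rule residual_le_step)
      show "\<alpha> n > 0" using a(1) a(2)[of n] by linarith
      have "x (Suc n) \<in> C' n" using xD[of n] Cstar(4)[of n] by (auto simp: D_def Cn_def)
      then show "(norm ((1 - \<alpha> n) *\<^sub>R x n + \<alpha> n *\<^sub>R T (x n) - x (Suc n)))\<^sup>2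
          \<le> (norm (x n - x (Suc n)))\<^sup>2 + \<alpha> n * (\<kappa> - (1 - \<alpha> n)) * (norm (x n - T (x n)))\<^sup>2"
        by (simp add: C'_def v)
    qed (rule k)
    then show "\<forall>\<^sub>F n in sequentially.
        norm (x n - T (x n)) \<le> 2 / (1 - \<kappa>) * norm (x n - x (Suc n))" by simp
    show "(\<lambda>n. 2 / (1 - \<kappa>) * norm (x n - x (Suc n))) \<longlonglongrightarrow> 0"
      by (intro tendsto_mult_right_zero steps)
  qed simp

  obtain p where p: "p \<in> ?F" and vi: "\<And>q. q \<in> ?F \<Longrightarrow> (x 0 - p) \<bullet> (q - p) \<le> 0"
    and appr: "\<And>e. e > 0 \<Longrightarrow> \<exists>r>0. \<exists>z\<in>C. z - T z = r *\<^sub>R (x 0 - z) \<and> dist z p < e"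
    using fixed_point_approximation[OF closC convC TC spc k F x0] by blast
  have bd: "norm (x n - p) \<le> norm (p - x 0)" for n
  proof (rule power2_le_imp_le)
    have "p \<in> Q n" using p FQ by blast
    then have "(norm (p - x n))\<^sup>2 \<le> (norm (p - x 0))\<^sup>2"
      using Q_pyth[of p n] zero_le_power2[of "norm (x n - x 0)"] by linarith
    then show "(norm (x n - p))\<^sup>2 \<le> (norm (p - x 0))\<^sup>2" by (simp add: norm_minus_commute)
  qed simp
  have key: "(norm (x n - p))\<^sup>2 \<le> (x 0 - p) \<bullet> (x n - p)" for n
  proof -
    have "p \<in> Q n" using p FQ by blast
    then show ?thesis unfolding Q_def power2_norm_eq_inner by (simp add: inner_diff inner_commute)
  qed
  have "x \<longlonglongrightarrow> p"
  proof (rule metric_LIMSEQ_I)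
    fix e :: real assume e: "e > 0"
    have "\<forall>\<^sub>F n in sequentially. (x 0 - p) \<bullet> (x n - p) < e\<^sup>2"
      by (rule approximate_fixed_points_inner[OF spc k(2) appr xC bd res]) (use e in auto)
    then have "\<forall>\<^sub>F n in sequentially. dist (x n) p < e"
    proof eventually_elim
      case (elim n)
      then have "(dist (x n) p)\<^sup>2 < e\<^sup>2" using key[of n] by (simp add: dist_norm)
      then show ?case using e power_less_imp_less_base[of "dist (x n) p" 2 e] by simp
    qed
    then show "\<exists>N. \<forall>n\<ge>N. dist (x n) p < e" by (simp add: eventually_sequentially)
  qed
  then show ?thesis using metric_projection_eqI[OF p vi] by simp
qed

end
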